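(* Let $K\subseteq\mathbb{R}^n$ be non-empty and closed and let $s=(s_\alpha)_{\alpha\in\mathbb{N}_0^n}$ be a real sequence. Then the following are equivalent: (i) $D(s)$ is a determinate $K$-positivity preserver; (ii) $s$ is a determinate $K^\sharp$-moment sequence.
   Context: $D(s):=\sum_{\alpha\in\mathbb{N}_0^n}\frac{s_\alpha}{\alpha!}\partial^\alpha$, acting on $\mathbb{R}[x_1,\dots,x_n]$. A linear map $T$ is a $K$-positivity preserver if $T\,\mathrm{Pos}(K)\subseteq\mathrm{Pos}(K)$, where $\mathrm{Pos}(K)$ is the set of polynomials non-negative on $K$. A $K$-positivity preserver $T=\sum_\alpha q_\alpha\partial^\alpha$ is called determinate if for every $y\in K$ the moment sequence $(\alpha!\,q_\alpha(y))_{\alpha}$ is determinate, i.e. has exactly one representing measure on $\mathbb{R}^n$. $K^\sharp:=\{x\in\mathbb{R}^n : x+K\subseteq K\}$. For closed $L\subseteq\mathbb{R}^n$, $s$ is an $L$-moment sequence if $s_\alpha=\int x^\alpha\,\mathrm{d}\mu$ for all $\alpha$ for some measure $\mu$ (a representing measure) with $\mathrm{supp}\,\mu\subseteq L$; it is determinate if it has only one representing measure on $\mathbb{R}^n$. *)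

theory Defs
  imports "HOL-Analysis.Analysis" "HOL-Library.Poly_Mapping"
begin

type_synonym 'n mpoly = "('n \<Rightarrow> nat) \<Rightarrow>\<^sub>0 real"

definition monom_val :: "real^'n \<Rightarrow> ('n \<Rightarrow> nat) \<Rightarrow> real" where
  "monom_val x \<alpha> = (\<Prod>i\<in>UNIV. (x $ i) ^ (\<alpha> i))"

definition mfact :: "('n::finite \<Rightarrow> nat) \<Rightarrow> real" where
  "mfact \<alpha> = (\<Prod>i\<in>UNIV. fact (\<alpha> i))"

definition peval :: "'n::finite mpoly \<Rightarrow> real^'n \<Rightarrow> real" where
  "peval p x = (\<Sum>\<gamma>\<in>Poly_Mapping.keys p. Poly_Mapping.lookup p \<gamma> * monom_val x \<gamma>)"

text \<open>Value at x of the partial derivative d^alpha p: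
  d^alpha x^gamma = gamma!/(gamma-alpha)! x^(gamma-alpha) if alpha \<le> gamma, else 0.\<close>
definition pderiv_eval :: "('n::finite \<Rightarrow> nat) \<Rightarrow> 'n mpoly \<Rightarrow> real^'n \<Rightarrow> real" where
  "pderiv_eval \<alpha> p x = (\<Sum>\<gamma>\<in>Poly_Mapping.keys p. if \<alpha> \<le> \<gamma>
      then Poly_Mapping.lookup p \<gamma> * (mfact \<gamma> / mfact (\<gamma> - \<alpha>)) * monom_val x (\<gamma> - \<alpha>) else 0)"

text \<open>Value at x of D(s) p = sum_alpha s_alpha/alpha! d^alpha p (only finitely many
  alpha, namely those below some exponent of p, give non-zero terms).\<close>
definition Ds_eval :: "(('n::finite \<Rightarrow> nat) \<Rightarrow> real) \<Rightarrow> 'n mpoly \<Rightarrow> real^'n \<Rightarrow> real" where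
  "Ds_eval s p x = (\<Sum>\<alpha>\<in>{\<alpha>. \<exists>\<gamma>\<in>Poly_Mapping.keys p. \<alpha> \<le> \<gamma>}. s \<alpha> / mfact \<alpha> * pderiv_eval \<alpha> p x)"

definition Ds_pos_preserver :: "(real^'n::finite) set \<Rightarrow> (('n \<Rightarrow> nat) \<Rightarrow> real) \<Rightarrow> bool" where
  "Ds_pos_preserver K s \<longleftrightarrow>
     (\<forall>p::'n mpoly. (\<forall>x\<in>K. peval p x \<ge> 0) \<longrightarrow> (\<forall>x\<in>K. Ds_eval s p x \<ge> 0))"

definition msupp :: "'a::topological_space measure \<Rightarrow> 'a set" where
  "msupp \<mu> = {x. \<forall>U. open U \<and> x \<in> U \<longrightarrow> emeasure \<mu> U > 0}"

definition represents :: "(real^'n::finite) set \<Rightarrow> (('n \<Rightarrow> nat) \<Rightarrow> real) \<Rightarrow> (real^'n) measure \<Rightarrow> bool" where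
  "represents L s \<mu> \<longleftrightarrow> sets \<mu> = sets (borel :: (real^'n) measure) \<and> msupp \<mu> \<subseteq> L \<and>
     (\<forall>\<alpha>. integrable \<mu> (\<lambda>x. monom_val x \<alpha>) \<and> (\<integral>x. monom_val x \<alpha> \<partial>\<mu>) = s \<alpha>)"

definition moment_seq :: "(real^'n::finite) set \<Rightarrow> (('n \<Rightarrow> nat) \<Rightarrow> real) \<Rightarrow> bool" where
  "moment_seq L s \<longleftrightarrow> (\<exists>\<mu>. represents L s \<mu>)"

definition determinate :: "(('n::finite \<Rightarrow> nat) \<Rightarrow> real) \<Rightarrow> bool" where
  "determinate s \<longleftrightarrow> (\<exists>!\<mu>. represents UNIV s \<mu>)"

text \<open>Determinacy of T = sum_alpha q_alpha d^alpha on K: for every y in K the sequence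
  (alpha! q_alpha(y)) is determinate.\<close>
definition determinate_op :: "(real^'n::finite) set \<Rightarrow> (('n \<Rightarrow> nat) \<Rightarrow> real^'n \<Rightarrow> real) \<Rightarrow> bool" where
  "determinate_op K q \<longleftrightarrow> (\<forall>y\<in>K. determinate (\<lambda>\<alpha>. mfact \<alpha> * q \<alpha> y))"

definition Ds_coeffs :: "(('n::finite \<Rightarrow> nat) \<Rightarrow> real) \<Rightarrow> ('n \<Rightarrow> nat) \<Rightarrow> real^'n \<Rightarrow> real" where
  "Ds_coeffs s \<alpha> y = s \<alpha> / mfact \<alpha>"

definition sharp :: "(real^'n::finite) set \<Rightarrow> (real^'n) set" where
  "sharp K = {x. \<forall>k\<in>K. x + k \<in> K}"

end

theory Submission
  imports Defs "HOL-Probability.Helly_Selection"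
begin

text \<open>
  By the binomial theorem, \<open>D(s) p\<close> at \<open>y\<close> is the integral of \<open>p (x + y)\<close> over any representing
  measure of \<open>s\<close>. If that measure lives on \<open>K\<^sup>\<sharp>\<close>, the integrand is non-negative for \<open>p\<close> in
  \<open>Pos(K)\<close> and \<open>y \<in> K\<close>. Conversely, if \<open>D(s)\<close> preserves \<open>Pos(K)\<close>, then for each \<open>y \<in> K\<close> the functional
  \<open>p \<mapsto> (D(s) p)(y)\<close> is represented by a measure on \<open>K\<close> (Haviland); its translate by \<open>- y\<close>
  represents \<open>s\<close>, so by determinacy the measure of \<open>s\<close> lives on \<open>K - y\<close> for every \<open>y \<in> K\<close>, that
  is on \<open>K\<^sup>\<sharp>\<close>.

  Haviland's theorem is obtained by separating the moment sequence from the cone of finitely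
  supported measures on \<open>K\<close> in finitely many coordinates, and passing to a weak limit of the
  resulting approximations.
\<close>

subsection \<open>A continuous surjection from the line onto Euclidean space\<close>

text \<open>Schoenberg's 2-periodic function: \<open>0\<close> on \<open>[0, 1/3]\<close> and \<open>1\<close> on \<open>[2/3, 1]\<close>, so that it reads off
  the ternary digits \<open>0\<close> and \<open>2\<close>.\<close>
definition plateau_wave :: "real \<Rightarrow> real" where
  "plateau_wave t = max 0 (min 1 (1 / 2 - cos (pi * t)))"

lemma plateau_wave_bounds: "0 \<le> plateau_wave t" "plateau_wave t \<le> 1"
  by (auto simp: plateau_wave_def)

lemma continuous_on_plateau_wave: "continuous_on A plateau_wave"
  unfolding plateau_wave_def by (intro continuous_intros)

lemma plateau_wave_periodic: "plateau_wave (2 * real k + t) = plateau_wave t"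
proof -
  have "pi * (2 * real k + t) = pi * t + 2 * real k * pi"
    by (simp add: algebra_simps)
  then have "cos (pi * (2 * real k + t)) = cos (pi * t)"
    by (simp only: cos_add cos_2npi sin_2npi)
  then show ?thesis
    by (simp add: plateau_wave_def)
qed

lemma plateau_wave_eq_0:
  assumes "0 \<le> t" "t \<le> 1 / 3"
  shows "plateau_wave t = 0"
proof -
  have "cos (pi * t) \<ge> cos (pi / 3)"
    using assms by (intro cos_monotone_0_pi_le) (auto simp: field_simps)
  then show ?thesis
    by (simp add: plateau_wave_def cos_60)
qed

lemma plateau_wave_eq_1:
  assumes "2 / 3 \<le> t" "t \<le> 1"
  shows "plateau_wave t = 1"
proof -
  have "cos (pi * t) \<le> cos (2 * pi / 3)"
    using assms by (intro cos_monotone_0_pi_le) (auto simp: field_simps)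
  then show ?thesis
    by (simp add: plateau_wave_def cos_120)
qed

text \<open>A point of the Cantor set: its ternary digits are \<open>2 * b j\<close>, so the digit 1
  never occurs and \<open>plateau_wave\<close> can read each digit off.\<close>

definition ternary :: "(nat \<Rightarrow> nat) \<Rightarrow> real" where
  "ternary b = (suminf (\<lambda>j. 2 * real (b j) / 3 ^ Suc j))"

lemma ternary_props:
  assumes "\<And>j. b j \<le> 1"
  shows "0 \<le> ternary b" "ternary b \<le> 1"
    and "3 * ternary b = 2 * real (b 0) + ternary (\<lambda>j. b (Suc j))"
proof -
  have geo: "(\<lambda>j. 2 / 3 ^ Suc j :: real) sums 1"
    using sums_mult[OF geometric_sums[of "1/3::real"], of "2/3"] by (simp add: power_divide)
  have le: "2 * real (c j) / 3 ^ Suc j \<le> 2 / 3 ^ Suc j" if "c j \<le> 1" for c :: "nat \<Rightarrow> nat" and j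
    using that by (intro divide_right_mono) auto
  have sm: "summable (\<lambda>j. 2 * real (c j) / 3 ^ Suc j)" if "\<And>j. c j \<le> 1" for c :: "nat \<Rightarrow> nat"
    by (rule summable_comparison_test'[OF sums_summable[OF geo], of 0]) (use le that in \<open>simp del: power_Suc\<close>)
  show "0 \<le> ternary b"
    unfolding ternary_def by (intro suminf_nonneg sm assms) auto
  have "ternary b \<le> (suminf (\<lambda>j. 2 / 3 ^ Suc j))"
    unfolding ternary_def by (intro suminf_le sm assms le sums_summable[OF geo])
  then show "ternary b \<le> 1"
    using sums_unique[OF geo] by simp
  have "ternary b = 2 * real (b 0) / 3 + (suminf (\<lambda>j. 2 * real (b (Suc j)) / 3 ^ Suc (Suc j)))"
    using suminf_split_head[OF sm[of b, OF assms]] by (simp add: ternary_def)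
  also have "(suminf (\<lambda>j. 2 * real (b (Suc j)) / 3 ^ Suc (Suc j))) = ternary (\<lambda>j. b (Suc j)) / 3"
    using suminf_divide[OF sm[of "\<lambda>j. b (Suc j)", OF assms], of 3]
    by (simp add: ternary_def mult.commute)
  finally show "3 * ternary b = 2 * real (b 0) + ternary (\<lambda>j. b (Suc j))"
    by simp
qed

text \<open>Each tripling moves one digit in front of the point. All digits are even, so the part in
  front stays even, that is, a multiple of the period of \<open>plateau_wave\<close>.\<close>

lemma ternary_shift:
  assumes "\<And>j. b j \<le> 1"
  shows "\<exists>N. 3 ^ m * ternary b = 2 * real N + ternary (\<lambda>j. b (m + j))"
proof (induction m)
  case 0
  show ?case by (intro exI[of _ 0]) simp
next
  case (Suc m)
  then obtain N where N: "3 ^ m * ternary b = 2 * real N + ternary (\<lambda>j. b (m + j))"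
    by blast
  have "3 ^ Suc m * ternary b = 2 * real (3 * N + b m) + ternary (\<lambda>j. b (Suc m + j))"
    using N ternary_props(3)[of "\<lambda>j. b (m + j)", OF assms] by (simp add: algebra_simps)
  then show ?case ..
qed

text \<open>Modulo 2 the argument is a number with leading ternary digit \<open>2 * b m\<close>; it
  lies in [0, 1/3] or in [2/3, 1], where the wave is constant. The summand \<open>2 * real k\<close>
  puts a copy of each point into every period, which later gives room for cubes of growing
  size.\<close>

lemma plateau_wave_ternary:
  assumes "\<And>j. b j \<le> 1"
  shows "plateau_wave (3 ^ m * (2 * real k + ternary b)) = real (b m)"
proof -
  obtain N where N: "3 ^ m * ternary b = 2 * real N + ternary (\<lambda>j. b (m + j))"
    using ternary_shift[of b m, OF assms] by blast
  let ?r = "ternary (\<lambda>j. b (m + j))"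
  have "3 ^ m * (2 * real k + ternary b) = 2 * real (3 ^ m * k + N) + ?r"
    using N by (simp add: algebra_simps)
  then have eq: "plateau_wave (3 ^ m * (2 * real k + ternary b)) = plateau_wave ?r"
    by (simp only: plateau_wave_periodic)
  have r: "3 * ?r = 2 * real (b m) + ternary (\<lambda>j. b (Suc (m + j)))"
    using ternary_props(3)[of "\<lambda>j. b (m + j)", OF assms] by simp
  have bd: "0 \<le> ternary (\<lambda>j. b (Suc (m + j)))" "ternary (\<lambda>j. b (Suc (m + j))) \<le> 1"
    by (intro ternary_props assms)+
  show ?thesis
  proof (cases "b m = 0")
    case True
    then show ?thesis
      unfolding eq using r bd by (simp add: plateau_wave_eq_0)
  next
    case False
    with assms[of m] have "b m = 1" by simp
    then show ?thesis
      unfolding eq using r bd by (simp add: plateau_wave_eq_1)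
  qed
qed

section \<open>Binary digits and a space-filling curve\<close>

lemma binary_expansion:
  fixes y :: real
  assumes "0 \<le> y" "y < 1"
  obtains a :: "nat \<Rightarrow> nat" where "\<And>k. a k \<le> 1" "(\<lambda>k. real (a k) / 2 ^ Suc k) sums y"
proof -
  \<comment> \<open>\<open>f N\<close> is the integer spelled by the first N binary digits of y, and
    \<open>a k\<close> is the last digit of \<open>f (Suc k)\<close>. The fact \<open>step\<close>
    shows that the subtraction of naturals does not truncate.\<close>
  define f where "f N = nat \<lfloor>2 ^ N * y\<rfloor>" for N
  define a where "a k = f (Suc k) - 2 * f k" for k
  have f: "real (f N) \<le> 2 ^ N * y" "2 ^ N * y < real (f N) + 1" for N
  proof -
    have "0 \<le> 2 ^ N * y" using assms by simp
    then have "real (f N) = of_int \<lfloor>2 ^ N * y\<rfloor>" unfolding f_def by simp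
    then show "real (f N) \<le> 2 ^ N * y" "2 ^ N * y < real (f N) + 1" by linarith+
  qed
  have step: "2 * f k \<le> f (Suc k)" "f (Suc k) \<le> 2 * f k + 1" for k
  proof -
    have "real (2 * f k) < real (f (Suc k) + 1)" "real (f (Suc k)) < real (2 * f k + 2)"
      using f[of k] f[of "Suc k"] by simp_all
    then show "2 * f k \<le> f (Suc k)" "f (Suc k) \<le> 2 * f k + 1"
      by (simp_all only: of_nat_less_iff)
  qed
  \<comment> \<open>The sum telescopes; the base case needs \<open>f 0 = 0\<close>, which is where
    \<open>y < 1\<close> enters.\<close>
  have part: "(\<Sum>k<N. real (a k) / 2 ^ Suc k) = real (f N) / 2 ^ N" for N
  proof (induction N)
    case 0
    show ?case using assms by (simp add: f_def)
  next
    case (Suc N)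
    have "real (a N) = real (f (Suc N)) - 2 * real (f N)"
      using step[of N] by (simp add: a_def of_nat_diff)
    then show ?case
      using Suc by (simp add: field_simps)
  qed
  have "(\<lambda>N. real (f N) / 2 ^ N) \<longlonglongrightarrow> y"
  proof (rule tendsto_sandwich[of "\<lambda>N. y - (1/2) ^ N" _ _ "\<lambda>_. y"])
    show "\<forall>\<^sub>F N in sequentially. y - (1/2) ^ N \<le> real (f N) / 2 ^ N"
      proof (intro always_eventually allI)
      fix N
      have "y - (1/2) ^ N = (2 ^ N * y - 1) / 2 ^ N"
        by (simp add: field_simps power_divide)
      also have "\<dots> \<le> real (f N) / 2 ^ N"
        using f(2)[of N] by (intro divide_right_mono) auto
      finally show "y - (1/2) ^ N \<le> real (f N) / 2 ^ N" .
    qed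
    show "\<forall>\<^sub>F N in sequentially. real (f N) / 2 ^ N \<le> y"
      using f(1) by (intro always_eventually allI) (simp add: field_simps)
    show "(\<lambda>N. y - (1/2) ^ N) \<longlonglongrightarrow> y"
      using tendsto_diff[OF tendsto_const LIMSEQ_realpow_zero[of "1/2"], of y] by simp
  qed simp
  then have "(\<lambda>k. real (a k) / 2 ^ Suc k) sums y"
    unfolding sums_def part .
  moreover have "a k \<le> 1" for k
    using step[of k] by (simp add: a_def)
  ultimately show thesis
    using that by blast
qed

text \<open>One parameter t encodes all coordinates: its ternary digits interleave the binary digits
  of every \<open>y i\<close>, and \<open>h i\<close> collects those that belong to i. Continuity
  follows from uniform convergence by the Weierstrass M-test.\<close>

lemma schoenberg_curve:
  obtains h :: "'n::finite \<Rightarrow> real \<Rightarrow> real"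
  where "\<And>i. continuous_on UNIV (h i)"
    and "\<And>y. \<forall>i. 0 \<le> y i \<and> y i < 1 \<Longrightarrow> \<exists>t\<in>{0..1}. \<forall>k i. h i (2 * real k + t) = y i"
proof -
  obtain e :: "'n \<Rightarrow> nat" where e: "inj e"
    using finite_imp_inj_to_nat_seg[of "UNIV :: 'n set"] by auto
  \<comment> \<open>Digit k of coordinate i is stored at position \<open>c i k\<close>; injectivity
    keeps the positions apart.\<close>
  define c where "c i k = prod_encode (e i, k)" for i k
  have c: "c i k = c j l \<longleftrightarrow> i = j \<and> k = l" for i j k l
    using e by (auto simp: c_def inj_def)
  define h where "h i t = (suminf (\<lambda>k. plateau_wave (3 ^ c i k * t) / 2 ^ Suc k))" for i t
  have geo: "summable (\<lambda>k. 1 / 2 ^ Suc k :: real)"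
    using power_half_series by (simp add: sums_iff power_divide)
  have cont: "continuous_on UNIV (h i)" for i
  proof -
    have "uniform_limit UNIV (\<lambda>N t. \<Sum>k<N. plateau_wave (3 ^ c i k * t) / 2 ^ Suc k) (h i) sequentially"
      unfolding h_def
    proof (rule Weierstrass_m_test[OF _ geo])
      show "norm (plateau_wave (3 ^ c i n * x) / 2 ^ Suc n) \<le> 1 / 2 ^ Suc n" for n x
        using plateau_wave_bounds[of "3 ^ c i n * x"] by (simp add: divide_right_mono)
    qed
    then show ?thesis
    proof (rule uniform_limit_theorem[rotated])
      show "\<forall>\<^sub>F N in sequentially. continuous_on UNIV (\<lambda>t. \<Sum>k<N. plateau_wave (3 ^ c i k * t) / 2 ^ Suc k)"
        by (intro always_eventually allI continuous_intros
            continuous_on_compose2[OF continuous_on_plateau_wave[of UNIV]]) auto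
    qed simp
  qed
  moreover have "\<exists>t\<in>{0..1}. \<forall>k i. h i (2 * real k + t) = y i"
    if y: "\<forall>i. 0 \<le> y i \<and> y i < 1" for y
  proof -
    have "\<exists>a. (\<forall>k. a k \<le> 1) \<and> (\<lambda>k. real (a k) / 2 ^ Suc k) sums y i" for i
      using y binary_expansion[of "y i"] by metis
    then obtain a where a: "\<And>i k. a i k \<le> (1::nat)"
      and sums: "\<And>i. (\<lambda>k. real (a i k) / 2 ^ Suc k) sums y i"
      by metis
    \<comment> \<open>Positions outside the range of \<open>c\<close> hold the digit 0. The two
      choices are made independently, but injectivity of \<open>c\<close> makes each of them
      unique.\<close>
    define b where "b m = (if \<exists>i k. m = c i k then a (SOME i. \<exists>k. m = c i k) (SOME k. \<exists>i. m = c i k) else 0)"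
      for m
    have b: "b (c i k) = a i k" for i k
      by (auto simp: b_def c)
    have b1: "b m \<le> 1" for m
      using a by (auto simp: b_def)
    have "h i (2 * real k + ternary b) = y i" for i k
      unfolding h_def plateau_wave_ternary[OF b1] b using sums[of i] by (simp add: sums_iff)
    then show ?thesis
      using ternary_props(1,2)[OF b1] by (intro bexI[of _ "ternary b"]) auto
  qed
  ultimately show thesis
    by (rule that)
qed

text \<open>The factor \<open>t - arccos (cos (pi t)) / pi\<close> equals \<open>2 k\<close> on \<open>[2 k, 2 k + 1]\<close>, so there the
  curve fills a cube of radius \<open>2 k\<close>.\<close>
lemma continuous_surj_real_vec:
  obtains G :: "real \<Rightarrow> real^'n::finite" and \<tau> :: "real^'n \<Rightarrow> real"
  where "continuous_on UNIV G" "\<And>x. G (\<tau> x) = x" "\<And>x. \<bar>\<tau> x\<bar> \<le> 2 * norm x + 5"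
proof -
  obtain h :: "'n \<Rightarrow> real \<Rightarrow> real" where h: "\<And>i. continuous_on UNIV (h i)"
    and surj: "\<And>y. \<forall>i. 0 \<le> y i \<and> y i < 1 \<Longrightarrow> \<exists>t\<in>{0..1}. \<forall>k i. h i (2 * real k + t) = y i"
    by (rule schoenberg_curve) blast
  define G :: "real \<Rightarrow> real^'n" where
    "G t = (t - arccos (cos (pi * t)) / pi) *\<^sub>R (\<chi> i. 2 * h i t - 1)" for t
  have "continuous_on UNIV G"
    unfolding G_def by (intro continuous_intros continuous_on_compose2[OF continuous_on_arccos'] h) auto
  moreover have "\<exists>t. G t = x \<and> \<bar>t\<bar> \<le> 2 * norm x + 5" for x
  proof -
    \<comment> \<open>As k exceeds \<open>norm x\<close>, the rescaled coordinates
      \<open>(x $ i / (2 * real k) + 1) / 2\<close> lie in [0, 1). As k is at most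
      \<open>norm x + 2\<close>, the parameter is at most 2 (norm x + 2) + 1; this linear growth
      will give tightness.\<close>
    define k where "k = Suc (nat \<lceil>norm x\<rceil>)"
    have k: "norm x < real k" "real k \<le> norm x + 2"
      using ceiling_correct[of "norm x"] norm_ge_zero[of x] unfolding k_def by linarith+
    then have k0: "0 < real k"
      using norm_ge_zero[of x] by linarith
    have bd: "\<bar>x $ i\<bar> < real k" for i
      using component_le_norm_cart[of x i] k(1) by linarith
    have "0 \<le> (x $ i / (2 * real k) + 1) / 2 \<and> (x $ i / (2 * real k) + 1) / 2 < 1" for i
      using bd[of i] k0 by (simp add: field_simps abs_less_iff)
    then obtain t where t: "0 \<le> t" "t \<le> 1"
      and ht: "\<And>k' i. h i (2 * real k' + t) = (x $ i / (2 * real k) + 1) / 2"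
      using surj[of "\<lambda>i. (x $ i / (2 * real k) + 1) / 2"] by fastforce
    have "pi * (2 * real k + t) = pi * t + 2 * real k * pi"
      by (simp add: algebra_simps)
    then have "cos (pi * (2 * real k + t)) = cos (pi * t)"
      by (simp only: cos_add cos_2npi sin_2npi)
    moreover have "arccos (cos (pi * t)) = pi * t"
      using t by (intro arccos_cos) auto
    ultimately have "G (2 * real k + t) = (2 * real k) *\<^sub>R (\<chi> i. x $ i / (2 * real k))"
      by (simp add: G_def ht add_divide_distrib)
    then have "G (2 * real k + t) = x"
      using k0 by (simp add: vec_eq_iff)
    moreover have "\<bar>2 * real k + t\<bar> \<le> 2 * norm x + 5"
      using k t by linarith
    ultimately show ?thesis by blast
  qed
  then obtain \<tau> where "\<And>x. G (\<tau> x) = x" "\<And>x. \<bar>\<tau> x\<bar> \<le> 2 * norm x + 5"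
    by metis
  ultimately show thesis
    by (rule that)
qed

subsection \<open>Approximation by finitely supported measures\<close>

definition sublinear :: "(('i \<Rightarrow> real) \<Rightarrow> real) \<Rightarrow> bool" where
  "sublinear q \<longleftrightarrow> (\<forall>u v. q (\<lambda>i. u i + v i) \<le> q u + q v) \<and>
    (\<forall>c\<ge>0. \<forall>u. q (\<lambda>i. c * u i) \<le> c * q u)"

lemma sublinearI:
  assumes "\<And>u v. q (\<lambda>i. u i + v i) \<le> q u + q v"
    and "\<And>c u. 0 \<le> c \<Longrightarrow> q (\<lambda>i. c * u i) \<le> c * q u"
  shows "sublinear q"
  using assms by (auto simp: sublinear_def)

lemma sublinear_add: "sublinear q \<Longrightarrow> q (\<lambda>i. u i + v i) \<le> q u + q v"
  by (simp add: sublinear_def)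

text \<open>For positive c the reverse inequality is scaling by \<open>1 / c\<close>, applied to the
  multiple of u by c. For c = 0, scaling gives q 0 \<le> 0 and subadditivity gives q 0 \<ge>
  0.\<close>

lemma sublinear_scale:
  assumes "sublinear q" "0 \<le> c"
  shows "q (\<lambda>i. c * u i) = c * q u"
proof (cases "c = 0")
  case True
  have "q (\<lambda>i. 0) \<le> 0" "q (\<lambda>i. 0) \<le> q (\<lambda>i. 0) + q (\<lambda>i. 0)"
    using assms(1) by (auto simp: sublinear_def dest: spec[of _ 0] spec[of _ "\<lambda>i. 0"])
  then show ?thesis using True by simp
next
  case False
  then have c: "0 < c" using assms(2) by simp
  from assms(1) have "\<forall>a\<ge>0. \<forall>u. q (\<lambda>i. a * u i) \<le> a * q u"
    by (simp add: sublinear_def)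
  from this[rule_format, of "1 / c" "\<lambda>i. c * u i"] have "c * q u \<le> q (\<lambda>i. c * u i)"
    using c by (simp add: field_simps)
  moreover have "q (\<lambda>i. c * u i) \<le> c * q u"
    using assms by (simp add: sublinear_def)
  ultimately show ?thesis by simp
qed

lemma sublinear_zero: "sublinear q \<Longrightarrow> q (\<lambda>i. 0) = 0"
  using sublinear_scale[of q 0] by simp

lemma sublinear_uminus: "sublinear q \<Longrightarrow> - q (\<lambda>i. - u i) \<le> q u"
  using sublinear_add[of q u "\<lambda>i. - u i"] sublinear_zero[of q] by simp

text \<open>Take \<open>q' v = INF t \<ge> 0. q (v + t g) - t q g\<close>. Together with \<open>sublinear_uminus\<close> the conclusion says
  that \<open>q'\<close> is linear along \<open>g\<close>.\<close>
lemma sublinear_linearize_direction: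
  assumes q: "sublinear q"
  obtains q' where "sublinear q'" "\<And>v. q' v \<le> q v" "q' (\<lambda>i. - g i) \<le> - q g"
proof -
  define F where "F v t = q (\<lambda>i. v i + t * g i) - t * q g" for v t
  define q' where "q' v = (INF t\<in>{0..}. F v t)" for v
  \<comment> \<open>A lower bound that does not depend on t keeps the infimum finite.\<close>
  have lower: "- q (\<lambda>i. - v i) \<le> F v t" if "0 \<le> t" for v t
    using sublinear_add[OF q, of "\<lambda>i. v i + t * g i" "\<lambda>i. - v i"] sublinear_scale[OF q that, of g]
    by (simp add: F_def)
  have bdd: "bdd_below (F v ` {0..})" for v
    by (intro bdd_belowI[of _ "- q (\<lambda>i. - v i)"]) (auto intro: lower)
  have le: "q' v \<le> F v t" if "0 \<le> t" for v t
    unfolding q'_def using that by (intro cINF_lower bdd) auto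
  have ge: "b \<le> q' v" if "\<And>t. 0 \<le> t \<Longrightarrow> b \<le> F v t" for b v
    unfolding q'_def using that by (intro cINF_greatest) auto
  have "sublinear q'"
  proof (rule sublinearI)
    fix u v
    have "q' (\<lambda>i. u i + v i) \<le> F u r + F v t" if "0 \<le> r" "0 \<le> t" for r t
    proof -
      have "q' (\<lambda>i. u i + v i) \<le> F (\<lambda>i. u i + v i) (r + t)"
        using that by (intro le) auto
      also have "\<dots> \<le> F u r + F v t"
        using sublinear_add[OF q, of "\<lambda>i. u i + r * g i" "\<lambda>i. v i + t * g i"]
        by (simp add: F_def algebra_simps)
      finally show ?thesis .
    qed
    then have "q' (\<lambda>i. u i + v i) - F v t \<le> q' u" if "0 \<le> t" for t
      using that by (intro ge) (simp add: algebra_simps)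
    then have "q' (\<lambda>i. u i + v i) - q' u \<le> q' v"
      by (intro ge) (simp add: algebra_simps)
    then show "q' (\<lambda>i. u i + v i) \<le> q' u + q' v" by simp
  next
    fix c :: real and u assume c: "0 \<le> c"
    show "q' (\<lambda>i. c * u i) \<le> c * q' u"
    proof (cases "c = 0")
      case True
      then show ?thesis
        using le[of 0 "\<lambda>i. 0"] sublinear_zero[OF q] by (simp add: F_def)
    next
      case False
      then have c: "0 < c" using c by simp
      have "q' (\<lambda>i. c * u i) / c \<le> F u t" if "0 \<le> t" for t
      proof -
        have "q' (\<lambda>i. c * u i) \<le> F (\<lambda>i. c * u i) (c * t)"
          using that c by (intro le) auto
        also have "\<dots> = c * F u t"
          using sublinear_scale[OF q, of c "\<lambda>i. u i + t * g i"] c by (simp add: F_def algebra_simps)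
        finally show ?thesis using c by (simp add: field_simps)
      qed
      then have "q' (\<lambda>i. c * u i) / c \<le> q' u" by (rule ge)
      then show ?thesis using c by (simp add: field_simps)
    qed
  qed
  moreover have "q' v \<le> q v" for v
    using le[of 0 v] by (simp add: F_def)
  moreover have "q' (\<lambda>i. - g i) \<le> - q g"
    using le[of 1 "\<lambda>i. - g i"] sublinear_zero[OF q] by (simp add: F_def)
  ultimately show thesis by (rule that)
qed

text \<open>Linearize along s first, then along the members of D one by one. Later steps only lower
  the functional, which preserves the linearity already gained: l' (-h) \<le> l (-h) \<le> - l h
  \<le> - l' h. For finite D this induction replaces Zorn's lemma.\<close>

lemma sublinear_linearize_finite:
  assumes q: "sublinear q" and "finite D"
  shows "\<exists>l. sublinear l \<and> (\<forall>v. l v \<le> q v) \<and> l (\<lambda>i. - s i) \<le> - q s \<and>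
    (\<forall>g\<in>D. l (\<lambda>i. - g i) \<le> - l g)"
  using \<open>finite D\<close>
proof induction
  case empty
  obtain l where "sublinear l" "\<And>v. l v \<le> q v" "l (\<lambda>i. - s i) \<le> - q s"
    by (rule sublinear_linearize_direction[OF q, of s]) blast
  then show ?case by blast
next
  case (insert g D)
  then obtain l where l: "sublinear l" "\<And>v. l v \<le> q v" "l (\<lambda>i. - s i) \<le> - q s"
    "\<And>g. g \<in> D \<Longrightarrow> l (\<lambda>i. - g i) \<le> - l g" by blast
  obtain l' where l': "sublinear l'" "\<And>v. l' v \<le> l v" "l' (\<lambda>i. - g i) \<le> - l g"
    by (rule sublinear_linearize_direction[OF l(1), of g]) blast
  have "l' (\<lambda>i. - h i) \<le> - l' h" if "h \<in> insert g D" for h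
    using that l'(3) l'(2)[of h] l'(2)[of "\<lambda>i. - h i"] l(4)[of h] by fastforce
  moreover have "l' v \<le> q v" for v
    using l'(2)[of v] l(2)[of v] by linarith
  moreover have "l' (\<lambda>i. - s i) \<le> - q s"
    using l'(2)[of "\<lambda>i. - s i"] l(3) by linarith
  ultimately show ?case
    using l'(1) by blast
qed

text \<open>As q sees only the coordinates in A, it suffices to linearize it along the unit vectors
  \<open>e j\<close> with j in A, and along s to keep the value \<open>q s\<close>. The coefficients
  are the values of the linearized functional at the unit vectors.\<close>

lemma hahn_banach_finite:
  assumes q: "sublinear q" and A: "finite A"
    and cong: "\<And>u v. (\<And>i. i \<in> A \<Longrightarrow> u i = v i) \<Longrightarrow> q u = q v"
  obtains c :: "'i \<Rightarrow> real" where "\<And>v. (\<Sum>i\<in>A. c i * v i) \<le> q v" "q s \<le> (\<Sum>i\<in>A. c i * s i)"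
proof -
  define e :: "'i \<Rightarrow> 'i \<Rightarrow> real" where "e j i = (if i = j then 1 else 0)" for i j
  define R where "R v = (\<lambda>i. if i \<in> A then v i else (0::real))" for v
  obtain l where l: "sublinear l" "\<And>v. l v \<le> q v" "l (\<lambda>i. - R s i) \<le> - q (R s)"
    and le: "\<And>j. j \<in> A \<Longrightarrow> l (\<lambda>i. - e j i) \<le> - l (e j)"
    using sublinear_linearize_finite[OF q finite_imageI[OF A, of e], of "R s"] by auto
  have qR: "q (R v) = q v" for v
    by (rule cong) (simp add: R_def)
  \<comment> \<open>For negative a this is where linearity along \<open>e j\<close> is used.\<close>
  have scale: "l (\<lambda>i. a * e j i) \<le> a * l (e j)" if "j \<in> A" for a j
  proof (cases "0 \<le> a")
    case True
    then show ?thesis using sublinear_scale[OF l(1)] by simp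
  next
    case False
    then have "l (\<lambda>i. (- a) * - e j i) \<le> (- a) * - l (e j)"
      using sublinear_scale[OF l(1), of "- a" "\<lambda>i. - e j i"] mult_left_mono_neg[OF le[OF that], of a]
      by simp
    then show ?thesis by simp
  qed
  have upper: "l (R v) \<le> (\<Sum>i\<in>A. l (e i) * v i)" for v
  proof -
    have "l (\<lambda>i. \<Sum>j\<in>B. v j * e j i) \<le> (\<Sum>j\<in>B. v j * l (e j))" if "B \<subseteq> A" for B
      using finite_subset[OF that A] that
    proof induction
      case empty
      then show ?case using sublinear_zero[OF l(1)] by simp
    next
      case (insert j B)
      have "l (\<lambda>i. v j * e j i + (\<Sum>j\<in>B. v j * e j i)) \<le>
          l (\<lambda>i. v j * e j i) + l (\<lambda>i. \<Sum>j\<in>B. v j * e j i)"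
        by (rule sublinear_add[OF l(1)])
      then show ?case
        using insert scale[of j "v j"] by (simp add: insert.hyps)
    qed
    from this[OF subset_refl] have "l (\<lambda>i. \<Sum>j\<in>A. v j * e j i) \<le> (\<Sum>j\<in>A. v j * l (e j))" .
    moreover have "(\<lambda>i. \<Sum>j\<in>A. v j * e j i) = R v"
      using A by (auto simp: R_def e_def fun_eq_iff if_distrib[of "(*) _"] cong: if_cong)
    ultimately show ?thesis by (simp add: mult.commute)
  qed
  show thesis
  proof (rule that[of "\<lambda>i. l (e i)"])
    fix v
    have "R (\<lambda>i. - v i) = (\<lambda>i. - R v i)" by (auto simp: R_def)
    \<comment> \<open>The upper bound for -v is a lower bound for \<open>l (R v)\<close>, so the
      linear form lies below l and hence below q.\<close>
    then have "- l (R v) \<le> l (R (\<lambda>i. - v i))"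
      using sublinear_uminus[OF l(1), of "\<lambda>i. - R v i"] by simp
    also have "\<dots> \<le> - (\<Sum>i\<in>A. l (e i) * v i)"
      using upper[of "\<lambda>i. - v i"] by (simp add: sum_negf)
    finally show "(\<Sum>i\<in>A. l (e i) * v i) \<le> q v"
      using l(2)[of "R v"] qR[of v] by linarith
  next
    show "q s \<le> (\<Sum>i\<in>A. l (e i) * s i)"
      using upper[of s] l(3) sublinear_uminus[OF l(1), of "R s"] qR[of s] by linarith
  qed
qed

text \<open>Hahn-Banach is applied to the l1-distance from C in the coordinates of A. The distance
  is at most 0 on C, hence so is the linear form below it; at t the form is at least the distance,
  which is at least \<epsilon>.\<close>

lemma convex_cone_separation:
  fixes C :: "('i \<Rightarrow> real) set"
  assumes add: "\<And>c d. c \<in> C \<Longrightarrow> d \<in> C \<Longrightarrow> (\<lambda>i. c i + d i) \<in> C"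
    and scale: "\<And>a c. 0 \<le> a \<Longrightarrow> c \<in> C \<Longrightarrow> (\<lambda>i. a * c i) \<in> C"
    and ne: "C \<noteq> {}" and A: "finite A" and "0 < \<epsilon>"
    and far: "\<And>c. c \<in> C \<Longrightarrow> \<exists>i\<in>A. \<epsilon> \<le> \<bar>t i - c i\<bar>"
  obtains l where "\<And>c. c \<in> C \<Longrightarrow> (\<Sum>i\<in>A. l i * c i) \<le> 0" "0 < (\<Sum>i\<in>A. l i * t i)"
proof -
  define N where "N v = (\<Sum>i\<in>A. \<bar>v i\<bar>)" for v :: "'i \<Rightarrow> real"
  \<comment> \<open>the distance to a convex cone is sublinear\<close>
  define q where "q v = (INF c\<in>C. N (\<lambda>i. v i - c i))" for v
  have N0: "0 \<le> N v" for v
    by (simp add: N_def sum_nonneg)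
  have bdd: "bdd_below ((\<lambda>c. N (\<lambda>i. v i - c i)) ` C)" for v
    by (intro bdd_belowI[of _ 0]) (auto intro: N0)
  have le: "q v \<le> N (\<lambda>i. v i - c i)" if "c \<in> C" for c v
    unfolding q_def using that by (intro cINF_lower bdd)
  have ge: "b \<le> q v" if "\<And>c. c \<in> C \<Longrightarrow> b \<le> N (\<lambda>i. v i - c i)" for b v
    unfolding q_def using that ne by (intro cINF_greatest)
  have "sublinear q"
  proof (rule sublinearI)
    fix u v
    have "q (\<lambda>i. u i + v i) \<le> N (\<lambda>i. u i - c i) + N (\<lambda>i. v i - d i)" if "c \<in> C" "d \<in> C" for c d
    proof -
      have "q (\<lambda>i. u i + v i) \<le> N (\<lambda>i. (u i + v i) - (c i + d i))"
        using le[OF add[OF that]] .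
      also have "\<dots> \<le> N (\<lambda>i. u i - c i) + N (\<lambda>i. v i - d i)"
        unfolding N_def sum.distrib[symmetric] by (intro sum_mono) linarith
      finally show ?thesis .
    qed
    then have "q (\<lambda>i. u i + v i) - N (\<lambda>i. v i - d i) \<le> q u" if "d \<in> C" for d
      using that by (intro ge) (simp add: algebra_simps)
    then have "q (\<lambda>i. u i + v i) - q u \<le> q v"
      by (intro ge) (simp add: algebra_simps)
    then show "q (\<lambda>i. u i + v i) \<le> q u + q v" by simp
  next
    fix a :: real and u assume a: "0 \<le> a"
    have *: "q (\<lambda>i. a * u i) \<le> a * N (\<lambda>i. u i - c i)" if "c \<in> C" for c
    proof -
      have "q (\<lambda>i. a * u i) \<le> N (\<lambda>i. a * u i - a * c i)"
        using le[OF scale[OF a that]] .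
      also have "\<dots> = a * N (\<lambda>i. u i - c i)"
        using a by (simp add: N_def right_diff_distrib[symmetric] abs_mult sum_distrib_left)
      finally show ?thesis .
    qed
    show "q (\<lambda>i. a * u i) \<le> a * q u"
    proof (cases "a = 0")
      case True
      then show ?thesis using * ne by auto
    next
      case False
      then have "q (\<lambda>i. a * u i) / a \<le> q u"
        using * a by (intro ge) (simp add: field_simps)
      then show ?thesis using a False by (simp add: field_simps)
    qed
  qed
  moreover have "q u = q v" if "\<And>i. i \<in> A \<Longrightarrow> u i = v i" for u v
    using that by (simp add: q_def N_def)
  ultimately obtain l where l: "\<And>v. (\<Sum>i\<in>A. l i * v i) \<le> q v" "q t \<le> (\<Sum>i\<in>A. l i * t i)"
    by (rule hahn_banach_finite[OF _ A, of q t]) blast+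
  have "(\<Sum>i\<in>A. l i * c i) \<le> 0" if "c \<in> C" for c
    using l(1)[of c] le[OF that, of c] by (simp add: N_def)
  moreover have "\<epsilon> \<le> q t"
  proof (rule ge)
    fix c assume "c \<in> C"
    then obtain i where "i \<in> A" "\<epsilon> \<le> \<bar>t i - c i\<bar>"
      using far by blast
    then show "\<epsilon> \<le> N (\<lambda>i. t i - c i)"
      using member_le_sum[of i A "\<lambda>i. \<bar>t i - c i\<bar>"] A by (simp add: N_def)
  qed
  then have "0 < (\<Sum>i\<in>A. l i * t i)"
    using l(2) \<open>0 < \<epsilon>\<close> by linarith
  ultimately show thesis by (rule that)
qed

section \<open>Riesz functionals and the cone of finitely supported measures\<close>

definition riesz :: "(('n::finite \<Rightarrow> nat) \<Rightarrow> real) \<Rightarrow> 'n mpoly \<Rightarrow> real" where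
  "riesz t p = (\<Sum>\<gamma>\<in>Poly_Mapping.keys p. Poly_Mapping.lookup p \<gamma> * t \<gamma>)"

lemma peval_eq_riesz: "peval p x = riesz (monom_val x) p"
  by (simp add: peval_def riesz_def)

text \<open>Turns a linear form on finitely many moments into a polynomial. Coefficients may vanish,
  so the keys need not exhaust A.\<close>

lemma mpoly_of_coeffs:
  fixes c :: "('n::finite \<Rightarrow> nat) \<Rightarrow> real"
  assumes "finite A"
  obtains p :: "'n mpoly" where "\<And>t. riesz t p = (\<Sum>\<alpha>\<in>A. c \<alpha> * t \<alpha>)"
proof
  fix t :: "('n \<Rightarrow> nat) \<Rightarrow> real"
  let ?c = "\<lambda>\<alpha>. if \<alpha> \<in> A then c \<alpha> else 0"
  let ?p = "Poly_Mapping.Abs_poly_mapping ?c"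
  have fin: "finite {\<alpha>. ?c \<alpha> \<noteq> 0}"
    by (rule finite_subset[OF _ assms]) auto
  have "Poly_Mapping.lookup ?p = ?c"
    by (rule lookup_Abs_poly_mapping[OF fin])
  moreover from this have "Poly_Mapping.keys ?p \<subseteq> A"
    by (auto simp: Poly_Mapping.in_keys_iff split: if_splits)
  ultimately show "riesz t ?p = (\<Sum>\<alpha>\<in>A. c \<alpha> * t \<alpha>)"
    unfolding riesz_def using assms
    by (intro sum.mono_neutral_cong_left) (auto simp: Poly_Mapping.in_keys_iff)
qed

text \<open>The moment sequences of finitely supported measures on K. Weights vanish off S, so that
  two such sums can be extended to the union of their supports and added.\<close>

definition moment_cone :: "(real^'n::finite) set \<Rightarrow> (('n \<Rightarrow> nat) \<Rightarrow> real) set" where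
  "moment_cone K = {(\<lambda>\<alpha>. \<Sum>x\<in>S. w x * monom_val x \<alpha>) | S w.
    finite S \<and> S \<subseteq> K \<and> (\<forall>x. 0 \<le> w x) \<and> (\<forall>x. x \<notin> S \<longrightarrow> w x = 0)}"

text \<open>Otherwise a linear form separates t from the cone. Its negative is a polynomial that is
  non-negative on K, because the Dirac measures at points of K belong to the cone, and yet
  \<open>riesz t\<close> is negative at it.\<close>

lemma moment_cone_approx:
  fixes K :: "(real^'n::finite) set"
  assumes pos: "\<And>p. (\<And>x. x \<in> K \<Longrightarrow> 0 \<le> peval p x) \<Longrightarrow> 0 \<le> riesz t p"
    and A: "finite A" and "0 < \<epsilon>"
  shows "\<exists>c\<in>moment_cone K. \<forall>\<alpha>\<in>A. \<bar>t \<alpha> - c \<alpha>\<bar> < \<epsilon>"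
proof (rule ccontr)
  let ?C = "moment_cone K"
  assume "\<not> ?thesis"
  then have far: "\<And>c. c \<in> ?C \<Longrightarrow> \<exists>\<alpha>\<in>A. \<epsilon> \<le> \<bar>t \<alpha> - c \<alpha>\<bar>"
    by (auto simp: not_less)
  have add: "(\<lambda>\<alpha>. c \<alpha> + d \<alpha>) \<in> ?C" if "c \<in> ?C" "d \<in> ?C" for c d
  proof -
    obtain S w where S: "c = (\<lambda>\<alpha>. \<Sum>x\<in>S. w x * monom_val x \<alpha>)"
      "finite S" "S \<subseteq> K" "\<forall>x. 0 \<le> w x" "\<forall>x. x \<notin> S \<longrightarrow> w x = 0"
      using \<open>c \<in> ?C\<close> by (auto simp: moment_cone_def)
    obtain T v where T: "d = (\<lambda>\<alpha>. \<Sum>x\<in>T. v x * monom_val x \<alpha>)"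
      "finite T" "T \<subseteq> K" "\<forall>x. 0 \<le> v x" "\<forall>x. x \<notin> T \<longrightarrow> v x = 0"
      using \<open>d \<in> ?C\<close> by (auto simp: moment_cone_def)
    have "c \<alpha> + d \<alpha> = (\<Sum>x\<in>S \<union> T. (w x + v x) * monom_val x \<alpha>)" for \<alpha>
    proof -
      have "c \<alpha> = (\<Sum>x\<in>S \<union> T. w x * monom_val x \<alpha>)"
        unfolding S(1) using S T by (intro sum.mono_neutral_left) auto
      moreover have "d \<alpha> = (\<Sum>x\<in>S \<union> T. v x * monom_val x \<alpha>)"
        unfolding T(1) using S T by (intro sum.mono_neutral_left) auto
      ultimately show ?thesis by (simp add: distrib_right sum.distrib)
    qed
    then show ?thesis
      unfolding moment_cone_def mem_Collect_eq using S T
      by (intro exI[of _ "S \<union> T"] exI[of _ "\<lambda>x. w x + v x"]) auto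
  qed
  have scale: "(\<lambda>\<alpha>. a * c \<alpha>) \<in> ?C" if "0 \<le> a" "c \<in> ?C" for a c
  proof -
    obtain S w where "c = (\<lambda>\<alpha>. \<Sum>x\<in>S. w x * monom_val x \<alpha>)"
      "finite S" "S \<subseteq> K" "\<forall>x. 0 \<le> w x" "\<forall>x. x \<notin> S \<longrightarrow> w x = 0"
      using \<open>c \<in> ?C\<close> by (auto simp: moment_cone_def)
    then show ?thesis
      unfolding moment_cone_def mem_Collect_eq using \<open>0 \<le> a\<close>
      by (intro exI[of _ S] exI[of _ "\<lambda>x. a * w x"]) (auto simp: sum_distrib_left mult.assoc)
  qed
  have point: "monom_val x \<in> ?C" if "x \<in> K" for x
    unfolding moment_cone_def mem_Collect_eq using that
    by (intro exI[of _ "{x}"] exI[of _ "\<lambda>y. if y = x then 1 else 0"]) auto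
  have zero: "(\<lambda>\<alpha>. 0) \<in> ?C"
    unfolding moment_cone_def mem_Collect_eq by (intro exI[of _ "{}"] exI[of _ "\<lambda>y. 0"]) auto
  then have "?C \<noteq> {}" by blast
  from convex_cone_separation[OF add scale this A \<open>0 < \<epsilon>\<close> far]
  obtain l where l: "\<And>c. c \<in> ?C \<Longrightarrow> (\<Sum>\<alpha>\<in>A. l \<alpha> * c \<alpha>) \<le> 0" "0 < (\<Sum>\<alpha>\<in>A. l \<alpha> * t \<alpha>)"
    by blast
  obtain p :: "'n mpoly" where p: "\<And>t. riesz t p = (\<Sum>\<alpha>\<in>A. - l \<alpha> * t \<alpha>)"
    using mpoly_of_coeffs[OF A, of "\<lambda>\<alpha>. - l \<alpha>"] by blast
  have "0 \<le> riesz t p"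
  proof (rule pos)
    fix x assume "x \<in> K"
    then show "0 \<le> peval p x"
      using l(1)[OF point, of x] by (simp add: peval_eq_riesz p sum_negf)
  qed
  then show False
    using l(2) by (simp add: p sum_negf)
qed

lemma finite_multiindex_box: "finite {\<alpha> :: 'n::finite \<Rightarrow> nat. \<forall>i. \<alpha> i \<le> k i}"
proof -
  have "{\<alpha> :: 'n \<Rightarrow> nat. \<forall>i. \<alpha> i \<le> k i} = Pi\<^sub>E UNIV (\<lambda>i. {..k i})"
    by (auto simp: PiE_def)
  then show ?thesis by (simp add: finite_PiE)
qed

text \<open>Stage d approximates the finitely many moments whose exponents are at most d; every
  multi-index is covered from some stage on. Division by the total mass gives probability
  weights.\<close>

lemma moment_approx_sequence:
  fixes K :: "(real^'n::finite) set"
  assumes pos: "\<And>p. (\<And>x. x \<in> K \<Longrightarrow> 0 \<le> peval p x) \<Longrightarrow> 0 \<le> riesz t p"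
    and t0: "0 < t (\<lambda>_. 0)"
  obtains S :: "nat \<Rightarrow> (real^'n) set" and w :: "nat \<Rightarrow> real^'n \<Rightarrow> real"
  where "\<And>d. finite (S d)" "\<And>d. S d \<subseteq> K" "\<And>d x. 0 \<le> w d x" "\<And>d. (\<Sum>x\<in>S d. w d x) = 1"
    and "\<And>\<alpha>. (\<lambda>d. \<Sum>x\<in>S d. w d x * monom_val x \<alpha>) \<longlonglongrightarrow> t \<alpha> / t (\<lambda>_. 0)"
proof -
  \<comment> \<open>The error tends to 0 and never exceeds \<open>t (\<lambda>_. 0)\<close>, so the
    mass \<open>m d\<close>, which differs from that value by strictly less than the error, is
    positive.\<close>
  define \<epsilon> where "\<epsilon> d = t (\<lambda>_. 0) / real (Suc d)" for d
  have \<epsilon>: "0 < \<epsilon> d" for d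
    using t0 by (simp add: \<epsilon>_def)
  have "\<exists>c\<in>moment_cone K. \<forall>\<alpha>\<in>{\<alpha>. \<forall>i. \<alpha> i \<le> d}. \<bar>t \<alpha> - c \<alpha>\<bar> < \<epsilon> d" for d
    by (rule moment_cone_approx[OF pos finite_multiindex_box \<epsilon>]) blast
  then have "\<exists>S w. finite S \<and> S \<subseteq> K \<and> (\<forall>x. 0 \<le> w x) \<and>
      (\<forall>\<alpha>. (\<forall>i. \<alpha> i \<le> d) \<longrightarrow> \<bar>t \<alpha> - (\<Sum>x\<in>S. w x * monom_val x \<alpha>)\<bar> < \<epsilon> d)" for d
    unfolding moment_cone_def by simp metis
  then obtain S w where S: "\<And>d. finite (S d)" "\<And>d. S d \<subseteq> K" "\<And>d x. 0 \<le> w d x"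
    and close: "\<And>d \<alpha>. (\<forall>i. \<alpha> i \<le> d) \<Longrightarrow> \<bar>t \<alpha> - (\<Sum>x\<in>S d. w d x * monom_val x \<alpha>)\<bar> < \<epsilon> d"
    by metis
  define m where "m d = (\<Sum>x\<in>S d. w d x)" for d
  have one: "monom_val x (\<lambda>_. 0) = 1" for x :: "real^'n"
    by (simp add: monom_val_def)
  have lim: "(\<lambda>d. \<Sum>x\<in>S d. w d x * monom_val x \<alpha>) \<longlonglongrightarrow> t \<alpha>" for \<alpha>
  proof (rule LIM_zero_cancel, rule Lim_null_comparison)
    have "\<alpha> i \<le> d" if "Max (range \<alpha>) \<le> d" for i d
      using that Max_ge[of "range \<alpha>" "\<alpha> i"] by simp
    then show "\<forall>\<^sub>F d in sequentially. norm ((\<Sum>x\<in>S d. w d x * monom_val x \<alpha>) - t \<alpha>) \<le> \<epsilon> d"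
      using close[of \<alpha>] unfolding eventually_sequentially real_norm_def
      by (intro exI[of _ "Max (range \<alpha>)"]) (metis abs_minus_commute less_imp_le)
    show "\<epsilon> \<longlonglongrightarrow> 0"
      using tendsto_mult_right_zero[OF LIMSEQ_inverse_real_of_nat, of "t (\<lambda>_. 0)"]
      by (simp add: \<epsilon>_def[abs_def] divide_inverse)
  qed
  have m: "0 < m d" for d
  proof -
    have "\<bar>t (\<lambda>_. 0) - m d\<bar> < \<epsilon> d"
      using close[of "\<lambda>_. 0" d] by (simp add: one m_def)
    moreover have "\<epsilon> d \<le> t (\<lambda>_. 0)"
      using t0 by (simp add: \<epsilon>_def field_simps)
    ultimately show ?thesis by linarith
  qed
  show thesis
  proof (rule that[of S "\<lambda>d x. w d x / m d"])
    show "(\<Sum>x\<in>S d. w d x / m d) = 1" for d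
      using m[of d] by (simp add: sum_divide_distrib[symmetric] m_def)
    show "(\<lambda>d. \<Sum>x\<in>S d. w d x / m d * monom_val x \<alpha>) \<longlonglongrightarrow> t \<alpha> / t (\<lambda>_. 0)" for \<alpha>
    proof -
      have "m \<longlonglongrightarrow> t (\<lambda>_. 0)"
        using lim[of "\<lambda>_. 0"] by (simp add: one m_def[abs_def])
      from tendsto_divide[OF lim[of \<alpha>] this] t0 show ?thesis
        by (simp add: sum_divide_distrib)
    qed
  qed (use S m in \<open>auto simp: less_imp_le\<close>)
qed

subsection \<open>Weak limits and Haviland's theorem\<close>

lemma abs_diff_clip_le:
  fixes y k :: real
  assumes "0 < k"
  shows "\<bar>y - max (- k) (min k y)\<bar> \<le> y\<^sup>2 / k"
proof (cases "\<bar>y\<bar> \<le> k")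
  case True
  then have "max (- k) (min k y) = y" by auto
  then show ?thesis using assms by simp
next
  case False
  have "\<bar>y - max (- k) (min k y)\<bar> \<le> \<bar>y\<bar>" using assms False by auto
  also have "\<bar>y\<bar> \<le> y\<^sup>2 / k"
    using False assms mult_left_mono[of k "\<bar>y\<bar>" "\<bar>y\<bar>"]
    by (simp add: field_simps power2_eq_square)
  finally show ?thesis .
qed

text \<open>The clipping error is 0 up to height k and at most f^2 / k beyond. The resulting bound
  is the same for all measures with second moment at most B, so a weak limit can be taken on the
  clipped functions.\<close>

lemma (in prob_space) expectation_clip_error:
  fixes f :: "'a \<Rightarrow> real"
  assumes [measurable]: "f \<in> borel_measurable M"
    and int: "integrable M (\<lambda>x. (f x)\<^sup>2)" and B: "expectation (\<lambda>x. (f x)\<^sup>2) \<le> B" and "0 < k"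
  shows "\<bar>expectation f - expectation (\<lambda>x. max (- k) (min k (f x)))\<bar> \<le> B / k"
proof -
  have f: "integrable M f"
    using square_integrable_imp_integrable[OF _ int] by simp
  have clip: "integrable M (\<lambda>x. max (- k) (min k (f x)))"
    by (rule Bochner_Integration.integrable_bound[OF f]) (use \<open>0 < k\<close> in auto)
  have "\<bar>expectation f - expectation (\<lambda>x. max (- k) (min k (f x)))\<bar>
      = \<bar>expectation (\<lambda>x. f x - max (- k) (min k (f x)))\<bar>"
    using f clip by simp
  also have "\<dots> \<le> expectation (\<lambda>x. \<bar>f x - max (- k) (min k (f x))\<bar>)"
    by (rule integral_abs_bound)
  also have "\<dots> \<le> expectation (\<lambda>x. (f x)\<^sup>2 / k)"
    using f clip int \<open>0 < k\<close> by (intro integral_mono abs_diff_clip_le) auto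
  also have "\<dots> \<le> B / k"
    using B \<open>0 < k\<close> by (simp add: divide_right_mono)
  finally show ?thesis .
qed

text \<open>The truncations of f^2 at height k are bounded and continuous, so the bound B passes to
  their integrals over the limit; Fatou's lemma then removes the truncation.\<close>

lemma weak_conv_square_integrable:
  fixes f :: "real \<Rightarrow> real"
  assumes M: "\<And>n. real_distribution (M n)" and N: "real_distribution N"
    and conv: "weak_conv_m M N" and f: "continuous_on UNIV f"
    and int: "\<And>n. integrable (M n) (\<lambda>x. (f x)\<^sup>2)"
    and B: "\<And>n. (\<integral>x. (f x)\<^sup>2 \<partial>M n) \<le> B"
  shows "integrable N (\<lambda>x. (f x)\<^sup>2)" "(\<integral>x. (f x)\<^sup>2 \<partial>N) \<le> B"
proof -
  interpret N: real_distribution N by fact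
  have [measurable]: "f \<in> borel_measurable borel"
    using f by (rule borel_measurable_continuous_onI)
  have "0 \<le> B"
    using order_trans[OF Bochner_Integration.integral_nonneg B[of 0]] by simp
  have le: "(\<integral>x. min ((f x)\<^sup>2) (real k) \<partial>N) \<le> B" for k
  proof (rule LIMSEQ_le_const2)
    show "(\<lambda>n. \<integral>x. min ((f x)\<^sup>2) (real k) \<partial>M n) \<longlonglongrightarrow> (\<integral>x. min ((f x)\<^sup>2) (real k) \<partial>N)"
      by (rule weak_conv_imp_integral_bdd_continuous_conv[OF M N conv, where B = "real k"])
        (use f in \<open>auto intro!: continuous_intros simp: continuous_on_eq_continuous_at\<close>)
    have "(\<integral>x. min ((f x)\<^sup>2) (real k) \<partial>M n) \<le> B" for n
    proof -
      interpret Mn: real_distribution "M n" by fact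
      have "(\<integral>x. min ((f x)\<^sup>2) (real k) \<partial>M n) \<le> (\<integral>x. (f x)\<^sup>2 \<partial>M n)"
        by (intro integral_mono int Bochner_Integration.integrable_bound[OF int]) auto
      then show ?thesis using B[of n] by linarith
    qed
    then show "\<exists>n0. \<forall>n\<ge>n0. (\<integral>x. min ((f x)\<^sup>2) (real k) \<partial>M n) \<le> B" by blast
  qed
  have "(\<integral>\<^sup>+x. ennreal ((f x)\<^sup>2) \<partial>N) =
      (\<integral>\<^sup>+x. liminf (\<lambda>k. ennreal (min ((f x)\<^sup>2) (real k))) \<partial>N)"
  proof (intro nn_integral_cong)
    fix x
    obtain k0 :: nat where "(f x)\<^sup>2 \<le> real k0"
      using real_arch_simple by blast
    then have "\<forall>\<^sub>F k in sequentially. ennreal (min ((f x)\<^sup>2) (real k)) = ennreal ((f x)\<^sup>2)"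
      unfolding eventually_sequentially by (intro exI[of _ k0]) (auto simp: min_def)
    then show "ennreal ((f x)\<^sup>2) = liminf (\<lambda>k. ennreal (min ((f x)\<^sup>2) (real k)))"
      by (intro lim_imp_Liminf[symmetric] tendsto_eventually) auto
  qed
  also have "\<dots> \<le> liminf (\<lambda>k. \<integral>\<^sup>+x. ennreal (min ((f x)\<^sup>2) (real k)) \<partial>N)"
    by (rule nn_integral_liminf) simp
  also have "\<dots> \<le> limsup (\<lambda>k. \<integral>\<^sup>+x. ennreal (min ((f x)\<^sup>2) (real k)) \<partial>N)"
    by (rule Liminf_le_Limsup) simp
  also have "\<dots> \<le> ennreal B"
  proof (rule Limsup_bounded, intro always_eventually allI)
    fix k :: nat
    have "integrable N (\<lambda>x. min ((f x)\<^sup>2) (real k))"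
      by (rule N.integrable_const_bound[where B = "real k"]) auto
    then show "(\<integral>\<^sup>+x. ennreal (min ((f x)\<^sup>2) (real k)) \<partial>N) \<le> ennreal B"
      using le[of k] by (subst nn_integral_eq_integral) (auto intro: ennreal_leI)
  qed
  finally have nn: "(\<integral>\<^sup>+x. ennreal ((f x)\<^sup>2) \<partial>N) \<le> ennreal B" .
  then show int_N: "integrable N (\<lambda>x. (f x)\<^sup>2)"
    by (intro integrableI_nonneg) (auto intro: le_less_trans)
  show "(\<integral>x. (f x)\<^sup>2 \<partial>N) \<le> B"
    using nn \<open>0 \<le> B\<close> by (subst (asm) nn_integral_eq_integral[OF int_N]) auto
qed

text \<open>Weak convergence handles the clipped function, and the second moments bound the clipping
  error by B / k for every \<open>M n\<close> and for N alike.\<close>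

lemma weak_conv_integral_square_bounded:
  fixes f :: "real \<Rightarrow> real"
  assumes M: "\<And>n. real_distribution (M n)" and N: "real_distribution N"
    and conv: "weak_conv_m M N" and f: "continuous_on UNIV f"
    and int: "\<And>n. integrable (M n) (\<lambda>x. (f x)\<^sup>2)"
    and B: "\<And>n. (\<integral>x. (f x)\<^sup>2 \<partial>M n) \<le> B"
  shows "integrable N f" "(\<lambda>n. \<integral>x. f x \<partial>M n) \<longlonglongrightarrow> (\<integral>x. f x \<partial>N)"
proof -
  interpret N: real_distribution N by fact
  have [measurable]: "f \<in> borel_measurable borel"
    using f by (rule borel_measurable_continuous_onI)
  note N2 = weak_conv_square_integrable[OF M N conv f int B]
  show "integrable N f"
    using N.square_integrable_imp_integrable[OF _ N2(1)] by simp
  have "0 \<le> B"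
    using order_trans[OF Bochner_Integration.integral_nonneg B[of 0]] by simp
  show "(\<lambda>n. \<integral>x. f x \<partial>M n) \<longlonglongrightarrow> (\<integral>x. f x \<partial>N)"
  proof (rule LIMSEQ_I)
    fix r :: real assume "0 < r"
    \<comment> \<open>Then B / k = r B / (3 B + 1) < r / 3, and the added 1 keeps k positive when B
      = 0. Two thirds of r pay for the two clipping errors, one for the clipped integrals.\<close>
    define k where "k = (3 * B + 1) / r"
    have "0 < k"
      using \<open>0 \<le> B\<close> \<open>0 < r\<close> by (simp add: k_def)
    have Bk: "B / k < r / 3"
      using \<open>0 \<le> B\<close> \<open>0 < r\<close> by (simp add: k_def field_simps)
    let ?g = "\<lambda>x. max (- k) (min k (f x))"
    have "(\<lambda>n. \<integral>x. ?g x \<partial>M n) \<longlonglongrightarrow> (\<integral>x. ?g x \<partial>N)"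
      by (rule weak_conv_imp_integral_bdd_continuous_conv[OF M N conv, where B = k])
        (use f \<open>0 < k\<close> in \<open>auto intro!: continuous_intros simp: continuous_on_eq_continuous_at\<close>)
    then obtain n0 where n0: "\<And>n. n \<ge> n0 \<Longrightarrow> \<bar>(\<integral>x. ?g x \<partial>M n) - (\<integral>x. ?g x \<partial>N)\<bar> < r / 3"
      using LIMSEQ_D[of _ _ "r / 3"] \<open>0 < r\<close> by fastforce
    have "norm ((\<integral>x. f x \<partial>M n) - (\<integral>x. f x \<partial>N)) < r" if "n \<ge> n0" for n
    proof -
      interpret Mn: real_distribution "M n" by fact
      have "\<bar>(\<integral>x. f x \<partial>M n) - (\<integral>x. ?g x \<partial>M n)\<bar> \<le> B / k"
        by (rule Mn.expectation_clip_error[OF _ int B \<open>0 < k\<close>]) simp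
      moreover have "\<bar>(\<integral>x. f x \<partial>N) - (\<integral>x. ?g x \<partial>N)\<bar> \<le> B / k"
        by (rule N.expectation_clip_error[OF _ N2 \<open>0 < k\<close>]) simp
      ultimately show ?thesis
        using n0[OF that] Bk unfolding real_norm_def by linarith
    qed
    then show "\<exists>n0. \<forall>n\<ge>n0. norm ((\<integral>x. f x \<partial>M n) - (\<integral>x. f x \<partial>N)) < r" by blast
  qed
qed

section \<open>Monomials and their second moments\<close>

lemma continuous_on_monom_val: "continuous_on A (\<lambda>x. monom_val x \<alpha>)"
  unfolding monom_val_def by (intro continuous_intros)

lemma borel_measurable_monom_val [measurable]: "(\<lambda>x. monom_val x \<alpha>) \<in> borel_measurable borel"
  by (intro borel_measurable_continuous_onI continuous_on_monom_val)

text \<open>The square is a monomial again, so bounds on moments are also bounds on the second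
  moments of all monomials.\<close>

lemma monom_val_square: "(monom_val x \<alpha>)\<^sup>2 = monom_val x (\<lambda>i. 2 * \<alpha> i)"
  by (simp add: monom_val_def prod_power_distrib power_mult[symmetric] mult.commute)

lemma norm_square_eq_sum_monom_val:
  "(norm x)\<^sup>2 = (\<Sum>i\<in>UNIV. monom_val x (\<lambda>j. if j = i then 2 else 0))"
proof -
  have eq: "(x $ i)\<^sup>2 = monom_val x (\<lambda>j. if j = i then 2 else 0)" for i
    by (simp add: monom_val_def if_distrib[of "power _"] cong: if_cong)
  then show ?thesis
    unfolding eq[symmetric] by (simp add: norm_vec_def L2_set_def sum_nonneg)
qed

text \<open>Helly selection is only available on the real line, so the approximating
  measures are transported there by a right inverse \<open>\<tau>\<close> of a continuous surjection \<open>G\<close>, and the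
  weak limit is pushed forward by \<open>G\<close>.\<close>
theorem haviland:
  fixes K :: "(real^'n::finite) set"
  assumes "closed K"
    and pos: "\<And>p. (\<And>x. x \<in> K \<Longrightarrow> 0 \<le> peval p x) \<Longrightarrow> 0 \<le> riesz t p"
    and t0: "0 < t (\<lambda>_. 0)"
  shows "moment_seq K t"
proof -
  obtain S :: "nat \<Rightarrow> (real^'n) set" and w
    where S: "\<And>d. finite (S d)" "\<And>d. S d \<subseteq> K"
      and w: "\<And>d x. 0 \<le> w d x" "\<And>d. (\<Sum>x\<in>S d. w d x) = 1"
      and lim: "\<And>\<alpha>. (\<lambda>d. \<Sum>x\<in>S d. w d x * monom_val x \<alpha>) \<longlonglongrightarrow> t \<alpha> / t (\<lambda>_. 0)"
    by (rule moment_approx_sequence[OF pos t0]) blast+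
  obtain G :: "real \<Rightarrow> real^'n" and \<tau> where G: "continuous_on UNIV G"
    and \<tau>: "\<And>x. G (\<tau> x) = x" "\<And>x. \<bar>\<tau> x\<bar> \<le> 2 * norm x + 5"
    by (rule continuous_surj_real_vec) blast
  have [measurable]: "G \<in> borel_measurable borel"
    using G by (rule borel_measurable_continuous_onI)
  have "K \<noteq> {}"
  proof
    assume "K = {}"
    then show False using S(2)[of 0] w(2)[of 0] by simp
  qed
  \<comment> \<open>The choice function \<open>\<tau>\<close> is measurable because a point measure
    carries all subsets of its finite space.\<close>
  define M where "M d = distr (point_measure (S d) (\<lambda>x. ennreal (w d x))) borel \<tau>" for d
  have M: "real_distribution (M d)" for d
  proof -
    have "prob_space (point_measure (S d) (\<lambda>x. ennreal (w d x)))"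
      by (rule prob_spaceI) (simp add: space_point_measure emeasure_point_measure_finite S w sum_ennreal)
    then show ?thesis
      unfolding M_def by (rule prob_space.real_distribution_distr) simp
  qed
  have int_M: "integrable (M d) f" and integral_M: "(\<integral>x. f x \<partial>M d) = (\<Sum>x\<in>S d. w d x * f (\<tau> x))"
    if [measurable]: "f \<in> borel_measurable borel" for f :: "real \<Rightarrow> real" and d
  proof -
    show "integrable (M d) f"
      unfolding M_def by (subst integrable_distr_eq) (auto intro: integrable_point_measure_finite S)
    show "(\<integral>x. f x \<partial>M d) = (\<Sum>x\<in>S d. w d x * f (\<tau> x))"
      unfolding M_def by (subst integral_distr) (auto simp: lebesgue_integral_point_measure_finite S w)
  qed
  have bounded: "\<exists>B. \<forall>d. (\<Sum>x\<in>S d. w d x * monom_val x \<alpha>) \<le> B" for \<alpha>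
  proof -
    obtain B where "\<And>d. norm (\<Sum>x\<in>S d. w d x * monom_val x \<alpha>) \<le> B"
      using BseqE[OF convergent_imp_Bseq[OF convergentI[OF lim[of \<alpha>]]]] by metis
    then show ?thesis by (metis abs_le_D1 real_norm_def)
  qed
  then obtain b where b: "\<And>\<alpha> d. (\<Sum>x\<in>S d. w d x * monom_val x \<alpha>) \<le> b \<alpha>"
    by metis
  have tight: "tight M"
    unfolding tight_def
  proof (intro conjI allI impI M)
    fix \<epsilon> :: real assume "0 < \<epsilon>"
    \<comment> \<open>The constants come from (2 a + 5)^2 \<le> 8 a^2 + 50, which is (2 a - 5)^2
      \<ge> 0, with a the norm of x.\<close>
    define B where "B = 8 * (\<Sum>i\<in>UNIV. b (\<lambda>j. if j = i then 2 else 0)) + 50"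
    have B: "(\<Sum>x\<in>S d. w d x * (\<tau> x)\<^sup>2) \<le> B" for d
    proof -
      have "(\<tau> x)\<^sup>2 \<le> 8 * (norm x)\<^sup>2 + 50" for x
      proof -
        have "(\<tau> x)\<^sup>2 \<le> (2 * norm x + 5)\<^sup>2"
          using power_mono[OF \<tau>(2)[of x], of 2] by simp
        also have "\<dots> \<le> 8 * (norm x)\<^sup>2 + 50"
          using zero_le_power2[of "2 * norm x - 5"] by (simp add: power2_eq_square algebra_simps)
        finally show ?thesis .
      qed
      then have "(\<Sum>x\<in>S d. w d x * (\<tau> x)\<^sup>2) \<le> (\<Sum>x\<in>S d. w d x * (8 * (norm x)\<^sup>2 + 50))"
        by (intro sum_mono mult_left_mono w)
      also have "\<dots> = 8 * (\<Sum>x\<in>S d. w d x * (norm x)\<^sup>2) + 50"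
        using w(2)[of d] by (simp add: distrib_left sum.distrib sum_distrib_left sum_distrib_right[symmetric] mult.left_commute)
      also have "(\<Sum>x\<in>S d. w d x * (norm x)\<^sup>2) =
          (\<Sum>i\<in>UNIV. \<Sum>x\<in>S d. w d x * monom_val x (\<lambda>j. if j = i then 2 else 0))"
        unfolding norm_square_eq_sum_monom_val sum_distrib_left by (rule sum.swap)
      also have "\<dots> \<le> (\<Sum>i\<in>UNIV. b (\<lambda>j. if j = i then 2 else 0))"
        by (intro sum_mono b)
      finally show ?thesis by (simp add: B_def)
    qed
    have "0 \<le> B"
      by (rule order_trans[OF _ B[of 0]]) (simp add: sum_nonneg w)
    \<comment> \<open>Then B / R^2 = \<epsilon> B / (B + 1) < \<epsilon>; the added 1 makes this
      strict and R positive.\<close>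
    define R where "R = sqrt ((B + 1) / \<epsilon>)"
    have R: "0 < R" "R\<^sup>2 = (B + 1) / \<epsilon>"
      using \<open>0 \<le> B\<close> \<open>0 < \<epsilon>\<close> by (simp_all add: R_def)
    have "1 - \<epsilon> < measure (M d) {- R<..R}" for d
    proof -
      interpret real_distribution "M d" by (rule M)
      have "B / R\<^sup>2 < \<epsilon>"
        using \<open>0 \<le> B\<close> \<open>0 < \<epsilon>\<close> by (simp add: R(2) field_simps)
      moreover have "(\<Sum>x\<in>S d. w d x * (\<tau> x)\<^sup>2) / R\<^sup>2 \<le> B / R\<^sup>2"
        using B by (rule divide_right_mono) simp
      moreover have "1 - (\<Sum>x\<in>S d. w d x * (\<tau> x)\<^sup>2) / R\<^sup>2 =
          (\<Sum>x\<in>S d. w d x * (1 - (\<tau> x)\<^sup>2 / R\<^sup>2))"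
        using w(2)[of d] by (simp add: right_diff_distrib sum_subtractf sum_divide_distrib)
      \<comment> \<open>Chebyshev's inequality in pointwise form: off the interval the left side is
        at most 0.\<close>
      moreover have "\<dots> \<le> (\<Sum>x\<in>S d. w d x * indicator {- R<..R} (\<tau> x))"
      proof (intro sum_mono mult_left_mono w)
        fix x
        show "1 - (\<tau> x)\<^sup>2 / R\<^sup>2 \<le> indicator {- R<..R} (\<tau> x)"
        proof (cases "\<tau> x \<in> {- R<..R}")
          case False
          then have "R \<le> \<bar>\<tau> x\<bar>" by auto
          then have "R\<^sup>2 \<le> (\<tau> x)\<^sup>2"
            using power_mono[of R "\<bar>\<tau> x\<bar>" 2] R(1) by simp
          then show ?thesis using False R(1) by (simp add: field_simps)
        qed simp
      qed
      moreover have "\<dots> = measure (M d) {- R<..R}"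
        using integral_M[of "indicator {- R<..R}" d] by simp
      ultimately show ?thesis by linarith
    qed
    then show "\<exists>a b. a < b \<and> (\<forall>d. 1 - \<epsilon> < measure (M d) {a<..b})"
      using R(1) by (intro exI[of _ "- R"] exI[of _ R]) auto
  qed
  obtain r N where r: "strict_mono r" and N: "real_distribution N" and "weak_conv_m (M \<circ> id \<circ> r) N"
    using tight_imp_convergent_subsubsequence[OF tight strict_mono_id] by blast
  then have conv: "weak_conv_m (\<lambda>d. M (r d)) N"
    by (simp add: comp_def)
  interpret N: real_distribution N by fact
  have moments: "integrable N (\<lambda>u. monom_val (G u) \<alpha>)"
    "(\<integral>u. monom_val (G u) \<alpha> \<partial>N) = t \<alpha> / t (\<lambda>_. 0)" for \<alpha>
  proof -
    have cont: "continuous_on UNIV (\<lambda>u. monom_val (G u) \<alpha>)"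
      by (rule continuous_on_compose2[OF continuous_on_monom_val G]) auto
    have int: "integrable (M (r d)) (\<lambda>u. (monom_val (G u) \<alpha>)\<^sup>2)" for d
      by (rule int_M) simp
    have bd: "(\<integral>u. (monom_val (G u) \<alpha>)\<^sup>2 \<partial>M (r d)) \<le> b (\<lambda>i. 2 * \<alpha> i)" for d
      using b by (subst integral_M) (auto simp: \<tau> monom_val_square)
    note * = weak_conv_integral_square_bounded[OF M N conv cont int bd]
    show "integrable N (\<lambda>u. monom_val (G u) \<alpha>)" by (rule *)
    have "(\<lambda>d. \<integral>u. monom_val (G u) \<alpha> \<partial>M (r d)) \<longlonglongrightarrow> t \<alpha> / t (\<lambda>_. 0)"
      using LIMSEQ_subseq_LIMSEQ[OF lim[of \<alpha>] r] by (simp add: integral_M \<tau> comp_def)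
    then show "(\<integral>u. monom_val (G u) \<alpha> \<partial>N) = t \<alpha> / t (\<lambda>_. 0)"
      using *(2) LIMSEQ_unique by blast
  qed
  have in_K: "AE u in N. G u \<in> K"
  proof -
    \<comment> \<open>The truncated distance to K is bounded and continuous, and it vanishes at
      every atom because \<open>G (\<tau> x) = x\<close>. Hence its integral over the limit is
      0.\<close>
    let ?f = "\<lambda>u. min 1 (infdist (G u) K)"
    have cont: "continuous_on UNIV ?f"
      by (intro continuous_intros G)
    then have [measurable]: "?f \<in> borel_measurable borel"
      by (rule borel_measurable_continuous_onI)
    have "(\<lambda>d. \<integral>u. ?f u \<partial>M (r d)) \<longlonglongrightarrow> (\<integral>u. ?f u \<partial>N)"
      by (rule weak_conv_imp_integral_bdd_continuous_conv[OF M N conv, where B = 1])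
        (use cont in \<open>auto simp: continuous_on_eq_continuous_at infdist_nonneg\<close>)
    moreover have "(\<integral>u. ?f u \<partial>M (r d)) = 0" for d
      using S(2)[of "r d"] by (subst integral_M) (auto simp: \<tau> subset_iff)
    ultimately have "(\<integral>u. ?f u \<partial>N) = 0"
      by (simp add: LIMSEQ_const_iff)
    moreover have "integrable N ?f"
      by (rule N.integrable_const_bound[where B = 1]) (auto simp: infdist_nonneg)
    ultimately have "AE u in N. ?f u = 0"
      by (subst (asm) integral_nonneg_eq_0_iff_AE) (auto simp: infdist_nonneg)
    then show ?thesis
    proof eventually_elim
      case (elim u)
      then have "infdist (G u) K = 0" by (simp add: min_def split: if_splits)
      then show ?case
        using in_closed_iff_infdist_zero[OF \<open>closed K\<close> \<open>K \<noteq> {}\<close>] by simp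
    qed
  qed
  \<comment> \<open>\<open>G\<close> carries the limit back to Euclidean space; the constant density
    restores the mass that was normalized to 1.\<close>
  define \<nu> where "\<nu> = density (distr N borel G) (\<lambda>_. ennreal (t (\<lambda>_. 0)))"
  have sets [simp]: "sets \<nu> = sets borel" by (simp add: \<nu>_def)
  have "msupp \<nu> \<subseteq> K"
  proof
    fix x assume x: "x \<in> msupp \<nu>"
    have "AE x in \<nu>. x \<in> K"
      unfolding \<nu>_def using in_K \<open>closed K\<close> by (subst AE_density) (auto simp: AE_distr_iff borel_closed)
    then have "emeasure \<nu> (- K) = 0"
      using \<open>closed K\<close> by (subst (asm) AE_iff_measurable[of "- K"]) (auto simp: \<nu>_def borel_open)
    then show "x \<in> K"
      using x \<open>closed K\<close> by (auto simp: msupp_def open_Compl dest: spec[of _ "- K"])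
  qed
  moreover have "integrable \<nu> (\<lambda>x. monom_val x \<alpha>) \<and> (\<integral>x. monom_val x \<alpha> \<partial>\<nu>) = t \<alpha>" for \<alpha>
    unfolding \<nu>_def using moments[of \<alpha>] t0
    by (simp add: integrable_density integral_density integrable_distr_eq integral_distr)
  ultimately have "represents K t \<nu>"
    by (simp add: represents_def)
  then show ?thesis
    unfolding moment_seq_def ..
qed

subsection \<open>Translation of moment sequences\<close>

text \<open>If s is the moment sequence of a measure, these are the moments of its translate by
  y.\<close>

definition shift_seq :: "(('n::finite \<Rightarrow> nat) \<Rightarrow> real) \<Rightarrow> real^'n \<Rightarrow> ('n \<Rightarrow> nat) \<Rightarrow> real" where
  "shift_seq s y \<gamma> =
    (\<Sum>\<alpha> | \<alpha> \<le> \<gamma>. (\<Prod>i\<in>UNIV. real (\<gamma> i choose \<alpha> i)) * monom_val y (\<gamma> - \<alpha>) * s \<alpha>)"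

lemma finite_multiindex_le: "finite {\<alpha> :: 'n::finite \<Rightarrow> nat. \<alpha> \<le> \<gamma>}"
  using finite_multiindex_box[of \<gamma>] by (simp add: le_fun_def)

text \<open>The binomial theorem in each coordinate; expanding the product of sums gives one term
  per multi-index below \<gamma>.\<close>

lemma monom_val_add: "monom_val (x + y) \<gamma> = shift_seq (monom_val x) y \<gamma>"
proof -
  have "monom_val (x + y) \<gamma> =
      (\<Prod>i\<in>UNIV. \<Sum>k\<le>\<gamma> i. real (\<gamma> i choose k) * (x $ i) ^ k * (y $ i) ^ (\<gamma> i - k))"
    by (simp add: monom_val_def binomial_ring)
  also have "\<dots> = (\<Sum>\<alpha>\<in>Pi\<^sub>E UNIV (\<lambda>i. {..\<gamma> i}).
      \<Prod>i\<in>UNIV. real (\<gamma> i choose \<alpha> i) * (x $ i) ^ \<alpha> i * (y $ i) ^ (\<gamma> i - \<alpha> i))"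
    by (rule prod_sum_PiE) auto
  also have "Pi\<^sub>E UNIV (\<lambda>i. {..\<gamma> i}) = {\<alpha>. \<alpha> \<le> \<gamma>}"
    by (auto simp: PiE_def le_fun_def)
  finally show ?thesis
    by (simp add: shift_seq_def monom_val_def prod.distrib mult_ac)
qed

text \<open>The quotient of \<gamma>! by \<alpha>! (\<gamma> - \<alpha>)! is a product of binomial
  coefficients, so D(s) acts on a monomial with the coefficients of its translate by y. What remains
  is an exchange of finite sums.\<close>

lemma Ds_eval_eq_riesz: "Ds_eval s p y = riesz (shift_seq s y) p"
proof -
  let ?I = "{\<alpha>. \<exists>\<gamma>\<in>Poly_Mapping.keys p. \<alpha> \<le> \<gamma>}"
  have "?I = (\<Union>\<gamma>\<in>Poly_Mapping.keys p. {\<alpha>. \<alpha> \<le> \<gamma>})"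
    by blast
  then have fin: "finite ?I"
    by (simp add: finite_multiindex_le)
  have mfact: "mfact \<gamma> / mfact (\<gamma> - \<alpha>) = mfact \<alpha> * (\<Prod>i\<in>UNIV. real (\<gamma> i choose \<alpha> i))"
    if "\<alpha> \<le> \<gamma>" for \<alpha> \<gamma> :: "'a \<Rightarrow> nat"
  proof -
    have "real (\<gamma> i choose \<alpha> i) = fact (\<gamma> i) / (fact (\<alpha> i) * fact (\<gamma> i - \<alpha> i))" for i
      using that by (simp add: le_fun_def binomial_fact)
    then show ?thesis
      by (simp add: mfact_def prod_dividef prod.distrib)
  qed
  have "mfact \<alpha> \<noteq> 0" for \<alpha> :: "'a \<Rightarrow> nat"
    by (simp add: mfact_def)
  then have summand: "s \<alpha> / mfact \<alpha> * (if \<alpha> \<le> \<gamma> then c * (mfact \<gamma> / mfact (\<gamma> - \<alpha>)) * monom_val y (\<gamma> - \<alpha>) else 0)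
      = (if \<alpha> \<le> \<gamma> then c * ((\<Prod>i\<in>UNIV. real (\<gamma> i choose \<alpha> i)) * monom_val y (\<gamma> - \<alpha>) * s \<alpha>) else 0)"
    for \<alpha> \<gamma> c
    by (simp add: mfact)
  have "Ds_eval s p y = (\<Sum>\<gamma>\<in>Poly_Mapping.keys p. \<Sum>\<alpha>\<in>?I. if \<alpha> \<le> \<gamma> then Poly_Mapping.lookup p \<gamma> *
      ((\<Prod>i\<in>UNIV. real (\<gamma> i choose \<alpha> i)) * monom_val y (\<gamma> - \<alpha>) * s \<alpha>) else 0)"
    unfolding Ds_eval_def pderiv_eval_def sum_distrib_left summand by (rule sum.swap)
  also have "\<dots> = riesz (shift_seq s y) p"
    unfolding riesz_def shift_seq_def sum_distrib_left
  proof (rule sum.cong[OF refl])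
    fix \<gamma> assume \<gamma>: "\<gamma> \<in> Poly_Mapping.keys p"
    show "(\<Sum>\<alpha>\<in>?I. if \<alpha> \<le> \<gamma> then Poly_Mapping.lookup p \<gamma> *
          ((\<Prod>i\<in>UNIV. real (\<gamma> i choose \<alpha> i)) * monom_val y (\<gamma> - \<alpha>) * s \<alpha>) else 0) =
        (\<Sum>\<alpha> | \<alpha> \<le> \<gamma>. Poly_Mapping.lookup p \<gamma> *
          ((\<Prod>i\<in>UNIV. real (\<gamma> i choose \<alpha> i)) * monom_val y (\<gamma> - \<alpha>) * s \<alpha>))"
      by (rule sum.mono_neutral_cong_right[OF fin]) (use \<gamma> in auto)
  qed
  finally show ?thesis .
qed

text \<open>The map f is kept general so that translation can be iterated: with x + y for
  \<open>f x\<close>, a further shift by -y recovers the original moments.\<close>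

lemma monom_val_integral_add:
  assumes int: "\<And>\<alpha>. integrable M (\<lambda>x. monom_val (f x) \<alpha>)"
    and t: "\<And>\<alpha>. (\<integral>x. monom_val (f x) \<alpha> \<partial>M) = t \<alpha>"
  shows "integrable M (\<lambda>x. monom_val (f x + y) \<gamma>)"
    and "(\<integral>x. monom_val (f x + y) \<gamma> \<partial>M) = shift_seq t y \<gamma>"
  unfolding monom_val_add shift_seq_def by (simp_all add: int t)

lemma riesz_integral:
  assumes "\<And>\<alpha>. integrable M (\<lambda>x. monom_val (f x) \<alpha>)"
    and "\<And>\<alpha>. (\<integral>x. monom_val (f x) \<alpha> \<partial>M) = t \<alpha>"
  shows "riesz t p = (\<integral>x. peval p (f x) \<partial>M)"
  by (simp add: riesz_def peval_def assms)

section \<open>Supports of representing measures\<close>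

lemma representsD:
  assumes "represents L s \<mu>"
  shows "sets \<mu> = sets borel" "msupp \<mu> \<subseteq> L"
    "integrable \<mu> (\<lambda>x. monom_val x \<alpha>)" "(\<integral>x. monom_val x \<alpha> \<partial>\<mu>) = s \<alpha>"
  using assms by (auto simp: represents_def)

text \<open>Each point off the support has a basic open neighbourhood of measure 0, and a countable
  basis contains only countably many of these.\<close>

lemma AE_msupp:
  fixes \<mu> :: "'a::second_countable_topology measure"
  assumes "sets \<mu> = sets borel"
  shows "AE x in \<mu>. x \<in> msupp \<mu>"
proof -
  obtain B :: "'a set set" where B: "countable B" "topological_basis B"
    using ex_countable_basis by blast
  have "(\<Union>U\<in>{U \<in> B. emeasure \<mu> U = 0}. U) \<in> null_sets \<mu>"
    using B topological_basis_open[OF B(2)]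
    by (intro null_sets_UN') (auto simp: null_sets_def assms)
  then show ?thesis
  proof (rule AE_I')
    show "{x \<in> space \<mu>. x \<notin> msupp \<mu>} \<subseteq> (\<Union>U\<in>{U \<in> B. emeasure \<mu> U = 0}. U)"
    proof
      fix x assume "x \<in> {x \<in> space \<mu>. x \<notin> msupp \<mu>}"
      then obtain U where U: "open U" "x \<in> U" "emeasure \<mu> U = 0"
        by (auto simp: msupp_def not_less)
      obtain V where V: "V \<in> B" "x \<in> V" "V \<subseteq> U"
        using topological_basisE[OF B(2) U(1,2)] .
      have "emeasure \<mu> V = 0"
        using emeasure_mono[OF V(3), of \<mu>] U by (simp add: assms)
      then show "x \<in> (\<Union>U\<in>{U \<in> B. emeasure \<mu> U = 0}. U)"
        using V by blast
    qed
  qed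
qed

lemma AE_represents:
  assumes "represents L s \<mu>"
  shows "AE x in \<mu>. x \<in> L"
  using AE_msupp[OF representsD(1)[OF assms]] representsD(2)[OF assms] by auto

section \<open>The two implications\<close>

lemma moment_seq_sharp_imp_pos_preserver:
  assumes "moment_seq (sharp K) s"
  shows "Ds_pos_preserver K s"
  unfolding Ds_pos_preserver_def
proof (intro allI impI ballI)
  fix p :: "'a mpoly" and y
  assume p: "\<forall>x\<in>K. 0 \<le> peval p x" and y: "y \<in> K"
  obtain \<mu> where \<mu>: "represents (sharp K) s \<mu>"
    using assms by (auto simp: moment_seq_def)
  have "Ds_eval s p y = (\<integral>x. peval p (x + y) \<partial>\<mu>)"
    unfolding Ds_eval_eq_riesz
    by (rule riesz_integral) (rule monom_val_integral_add[of \<mu> "\<lambda>x. x", OF representsD(3,4)[OF \<mu>]])+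
  also have "\<dots> \<ge> 0"
  proof (rule integral_nonneg_AE)
    show "AE x in \<mu>. 0 \<le> peval p (x + y)"
      using AE_represents[OF \<mu>] by eventually_elim (use p y in \<open>auto simp: sharp_def\<close>)
  qed
  finally show "0 \<le> Ds_eval s p y" .
qed

text \<open>For fixed y in K, Haviland's theorem represents the shifted sequence on K. Translating
  that measure back by -y represents s, so by uniqueness it is \<mu>, and no point of its support is
  moved out of K by y.\<close>

lemma determinate_pos_preserver_msupp:
  fixes K :: "(real^'n::finite) set"
  assumes "closed K" and pres: "Ds_pos_preserver K s"
    and unique: "\<And>\<nu>. represents UNIV s \<nu> \<Longrightarrow> \<nu> = \<mu>" and \<mu>: "represents UNIV s \<mu>"
  shows "msupp \<mu> \<subseteq> sharp K"
proof
  fix z assume z: "z \<in> msupp \<mu>"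
  have "z + y \<in> K" if y: "y \<in> K" for y
  proof (rule ccontr)
    assume nz: "z + y \<notin> K"
    define t where "t = shift_seq s y"
    note \<mu>y = monom_val_integral_add[of \<mu> "\<lambda>x. x" s y, OF representsD(3,4)[OF \<mu>], folded t_def]
    have space: "space \<mu> = UNIV"
      using sets_eq_imp_space_eq[OF representsD(1)[OF \<mu>]] by simp
    \<comment> \<open>The monomial 1 is integrable, so the total mass is finite; it is positive
      because the support contains z. Haviland's theorem asks for this positivity.\<close>
    have "integrable \<mu> (\<lambda>x. 1 :: real)"
      using representsD(3)[OF \<mu>, of "\<lambda>_. 0"] by (simp add: monom_val_def)
    then interpret \<mu>: finite_measure \<mu>
      by (intro finite_measureI) (auto simp: integrable_iff_bounded top_unique less_top)
    have "0 < emeasure \<mu> UNIV"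
      using z by (auto simp: msupp_def)
    then have "0 < measure \<mu> (space \<mu>)"
      by (simp add: space \<mu>.emeasure_eq_measure)
    then have "0 < t (\<lambda>_. 0)"
      using \<mu>y(2)[of "\<lambda>_. 0"] by (simp add: monom_val_def)
    moreover have "0 \<le> riesz t p" if "\<And>x. x \<in> K \<Longrightarrow> 0 \<le> peval p x" for p
      using pres y that by (auto simp: Ds_pos_preserver_def Ds_eval_eq_riesz t_def)
    ultimately obtain \<nu> where \<nu>: "represents K t \<nu>"
      using haviland[OF \<open>closed K\<close>] by (auto simp: moment_seq_def)
    \<comment> \<open>Both sides are moments of (x + y) - y under \<mu>, so the shifts cancel
      without any binomial identity.\<close>
    have s: "shift_seq t (- y) \<gamma> = s \<gamma>" for \<gamma>
      using monom_val_integral_add(2)[OF \<mu>y, of "- y" \<gamma>] representsD(4)[OF \<mu>, of \<gamma>] by simp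
    have [measurable_cong]: "sets \<nu> = sets borel"
      by (rule representsD(1)[OF \<nu>])
    have "represents UNIV s (distr \<nu> borel (\<lambda>x. x + - y))"
      using monom_val_integral_add[of \<nu> "\<lambda>x. x" t "- y", OF representsD(3,4)[OF \<nu>]]
      unfolding represents_def s by (simp add: integrable_distr_eq integral_distr)
    then have \<mu>_eq: "\<mu> = distr \<nu> borel (\<lambda>x. x + - y)"
      using unique by simp
    \<comment> \<open>The points that translation by y moves out of K: an open neighbourhood of z,
      and a null set because \<nu> lives on K.\<close>
    define U where "U = (\<lambda>x. x + y) -` (- K)"
    have "open U"
      unfolding U_def using \<open>closed K\<close> by (intro open_vimage continuous_intros open_Compl)
    moreover have "emeasure \<mu> U = 0"
    proof -
      have "emeasure \<mu> U = emeasure \<nu> ((\<lambda>x. x + - y) -` U \<inter> space \<nu>)"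
        unfolding \<mu>_eq using \<open>open U\<close> by (intro emeasure_distr) auto
      also have "(\<lambda>x. x + - y) -` U \<inter> space \<nu> = {x \<in> space \<nu>. x \<notin> K}"
        by (auto simp: U_def)
      also have "emeasure \<nu> {x \<in> space \<nu>. x \<notin> K} = 0"
        using AE_represents[OF \<nu>] \<open>closed K\<close> by (intro emeasure_eq_0_AE) auto
      finally show ?thesis .
    qed
    moreover have "z \<in> U"
      using nz by (simp add: U_def)
    ultimately show False
      using z by (auto simp: msupp_def)
  qed
  then show "z \<in> sharp K"
    by (simp add: sharp_def)
qed

text \<open>The coefficients of D(s) are constant in y and the factor \<alpha>! cancels; a point of
  K turns the condition for all y in K into one on s.\<close>

lemma determinate_op_Ds_coeffs:
  assumes "K \<noteq> {}"
  shows "determinate_op K (Ds_coeffs s) \<longleftrightarrow> determinate s"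
proof -
  have "mfact \<alpha> \<noteq> 0" for \<alpha> :: "'a \<Rightarrow> nat"
    by (simp add: mfact_def)
  then show ?thesis
    using assms by (auto simp: determinate_op_def Ds_coeffs_def)
qed

theorem theorem4p12:
  fixes K :: "(real^'n::finite) set" and s :: "('n \<Rightarrow> nat) \<Rightarrow> real"
  assumes "K \<noteq> {}" and "closed K"
  shows "(Ds_pos_preserver K s \<and> determinate_op K (Ds_coeffs s)) \<longleftrightarrow>
         (moment_seq (sharp K) s \<and> determinate s)"
proof -
  have "moment_seq (sharp K) s" if "Ds_pos_preserver K s" "determinate s"
  proof -
    obtain \<mu> where \<mu>: "represents UNIV s \<mu>" "\<And>\<nu>. represents UNIV s \<nu> \<Longrightarrow> \<nu> = \<mu>"
      using \<open>determinate s\<close> unfolding determinate_def by blast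
    have "represents (sharp K) s \<mu>"
      using determinate_pos_preserver_msupp[OF \<open>closed K\<close> that(1) \<mu>(2,1)] \<mu>(1)
      by (simp add: represents_def)
    then show ?thesis
      by (auto simp: moment_seq_def)
  qed
  then show ?thesis
    using moment_seq_sharp_imp_pos_preserver determinate_op_Ds_coeffs[OF \<open>K \<noteq> {}\<close>] by blast
qed

end
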